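(* For every $n\ge1$, \[ \sum_{\sigma\in V_n}x^{\mathrm{des}_B(\sigma)}=\sum_{e\in I_{2n-1}}x^{\mathrm{asc}(e)}. \]
   Context: A signed permutation on a multiset $M$ of positive integers is a word $\sigma=\sigma_1\cdots\sigma_m$ obtained by arranging the elements of $M$ in some order and possibly negating each letter. Letters are compared as integers. Define $\mathrm{Des}_B(\sigma)=\{i:1\le i\le m-1,\ \sigma_i>\sigma_{i+1}\}\cup\{m\text{ if }\sigma_m>0\}$ and $\mathrm{des}_B(\sigma)=|\mathrm{Des}_B(\sigma)|$. $V_n$ is the set of signed permutations on the multiset $\{1^2,2^2,\ldots,(n-1)^2,n\}$ in which the (unique) letter $n$ carries a minus sign. For a sequence $s=(s_1,s_2,\ldots)$ of positive integers, an $s$-inversion sequence of length $m$ is a sequence $e=(e_1,\ldots,e_m)$ of integers with $0\le e_i<s_i$. Set $e_0=0$ and $s_0=1$. An ascent of $e$ is an index $i\in\{0,\ldots,m-1\}$ with $e_i/s_i<e_{i+1}/s_{i+1}$, and $\mathrm{asc}(e)$ is the number of ascents. $I_m$ is the set of $s$-inversion sequences of length $m$ for $s_{2i}=4i$ and $s_{2i-1}=2i-1$ ($i\ge1$), i.e. $s=(1,4,3,8,5,12,\ldots)$. *)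

theory Defs
  imports Complex_Main "HOL-Library.Multiset" "HOL-Computational_Algebra.Polynomial"
begin

definition signed_perms :: "nat multiset \<Rightarrow> int list set" where
  "signed_perms M = {\<sigma>. image_mset (\<lambda>z. nat \<bar>z\<bar>) (mset \<sigma>) = M}"

(* Positions are 1-based: the letter at position i is the list entry with index i - 1. *)
definition Des_B :: "int list \<Rightarrow> nat set" where
  "Des_B \<sigma> = {i. 1 \<le> i \<and> i < length \<sigma> \<and> \<sigma> ! (i - 1) > \<sigma> ! i}
             \<union> {m. m = length \<sigma> \<and> 1 \<le> m \<and> \<sigma> ! (m - 1) > 0}"

definition des_B :: "int list \<Rightarrow> nat" where
  "des_B \<sigma> = card (Des_B \<sigma>)"

definition V :: "nat \<Rightarrow> int list set" where
  "V n = {\<sigma> \<in> signed_perms ((\<Sum>i\<in>{1..<n}. replicate_mset 2 i) + {#n#}). - int n \<in> set \<sigma>}"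

(* A sequence s is a function on the naturals of which only the values at positive arguments
   matter; the list entry with index i - 1 of an inversion sequence is e_i. *)
definition inv_seqs :: "(nat \<Rightarrow> nat) \<Rightarrow> nat \<Rightarrow> nat list set" where
  "inv_seqs s m = {e. length e = m \<and> (\<forall>i\<in>{1..m}. e ! (i - 1) < s i)}"

(* 0 # e and s(0 := 1) implement the conventions e_0 = 0 and s_0 = 1. *)
definition asc :: "(nat \<Rightarrow> nat) \<Rightarrow> nat list \<Rightarrow> nat" where
  "asc s e = card {i. i < length e \<and>
     real ((0 # e) ! i) / real ((s(0 := 1)) i)
       < real ((0 # e) ! (i + 1)) / real ((s(0 := 1)) (i + 1))}"

definition s_seq :: "nat \<Rightarrow> nat" where
  "s_seq k = (if even k then 2 * k else k)"

lemma s_seq_even: "s_seq (2 * i) = 4 * i"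
  by (simp add: s_seq_def)

lemma s_seq_odd: "1 \<le> i \<Longrightarrow> s_seq (2 * i - 1) = 2 * i - 1"
  by (simp add: s_seq_def)

definition I :: "nat \<Rightarrow> nat list set" where
  "I m = inv_seqs s_seq m"

lemma finite_signed_perms: "finite (signed_perms M)"
proof (rule finite_subset)
  let ?A = "(int ` set_mset M) \<union> (uminus ` int ` set_mset M)"
  show "signed_perms M \<subseteq> {\<sigma>. set \<sigma> \<subseteq> ?A \<and> length \<sigma> = size M}"
  proof
    fix \<sigma> assume "\<sigma> \<in> signed_perms M"
    then have M: "M = image_mset (\<lambda>z. nat \<bar>z\<bar>) (mset \<sigma>)"
      by (simp add: signed_perms_def)
    have "z \<in> ?A" if "z \<in> set \<sigma>" for z
    proof -
      have "nat \<bar>z\<bar> \<in> set_mset M" using that M by auto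
      moreover have "z = int (nat \<bar>z\<bar>) \<or> z = - int (nat \<bar>z\<bar>)" by auto
      ultimately show ?thesis by blast
    qed
    with M show "\<sigma> \<in> {\<sigma>. set \<sigma> \<subseteq> ?A \<and> length \<sigma> = size M}"
      by auto
  qed
  show "finite {\<sigma>. set \<sigma> \<subseteq> ?A \<and> length \<sigma> = size M}"
    by (rule finite_lists_length_eq) simp
qed

lemma finite_V: "finite (V n)"
  by (rule finite_subset[OF _ finite_signed_perms]) (auto simp: V_def)

lemma finite_inv_seqs: "finite (inv_seqs s m)"
proof (rule finite_subset)
  let ?A = "\<Union>i\<in>{1..m}. {..<s i}"
  show "inv_seqs s m \<subseteq> {e. set e \<subseteq> ?A \<and> length e = m}"
  proof
    fix e assume "e \<in> inv_seqs s m"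
    then have len: "length e = m" and lt: "\<And>i. i \<in> {1..m} \<Longrightarrow> e ! (i - 1) < s i"
      unfolding inv_seqs_def by blast+
    have "set e \<subseteq> ?A"
    proof
      fix x assume "x \<in> set e"
      then obtain j where "j < length e" and x: "e ! j = x"
        unfolding in_set_conv_nth by blast
      then have j: "Suc j \<in> {1..m}" using len by simp
      have "x \<in> {..<s (Suc j)}" using lt[OF j] x by simp
      with j show "x \<in> ?A" by (rule UN_I)
    qed
    with len show "e \<in> {e. set e \<subseteq> ?A \<and> length e = m}" by blast
  qed
  show "finite {e. set e \<subseteq> ?A \<and> length e = m}"
    by (rule finite_lists_length_eq) simp
qed

lemma finite_I: "finite (I m)"
  by (simp add: I_def finite_inv_seqs)

end

theory Submission
  imports Defs "HOL-Computational_Algebra.Polynomial_FPS" "HOL-Library.Product_Lexorder"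
begin

text \<open>
  Both sides equal \<open>(1 - x)\<^bsup>2n\<^esup> \<Sum>\<^sub>t (t+1) ((t+1)(2t+1))\<^bsup>n-1\<^esup> x\<^sup>t\<close>.

  For inversion sequences, the generating function of those of length \<open>m\<close> with last entry \<open>i\<close> is
  \<open>(1 - x)\<^sup>m \<Sum>\<^sub>q a\<^sub>m(i, q) x\<^sup>q\<close>, where \<open>a\<^sub>m(i, q)\<close> counts lecture hall sequences. Passing from \<open>m\<close> to
  \<open>m + 1\<close> means taking partial sums over \<open>i\<close>, and these telescope because \<open>a\<^sub>m(i, q)\<close> is an explicit
  product of linear factors in \<open>q\<close>.

  For signed permutations, \<open>x\<^bsup>des \<sigma>\<^esup> / (1 - x)\<^bsup>2n\<^esup>\<close> counts the ways to insert \<open>t\<close> bars into \<open>\<sigma>\<close> so that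
  every descent is crossed by one. A barred word is a sorted list of (compartment, letter) pairs,
  i.e. a multiset of such pairs. Each doubled letter can be placed in \<open>2t+1\<close> ways per copy, giving
  \<open>(t+1)(2t+1)\<close> multisets of size two, and the negative letter \<open>-n\<close> has \<open>t+1\<close> compartments.
\<close>

section \<open>Inversion sequences\<close>

text \<open>
  Let \<^term>\<open>m = 2*N+1\<close> for \<open>odd_count\<close> and \<^term>\<open>m = 2*N+2\<close> for \<open>even_count\<close>, and write \<open>s\<^sub>k\<close> for the
  sequence \<open>1, 4, 3, 8, 5, \<dots>\<close>. The value at \<^term>\<open>i\<close> and \<^term>\<open>q\<close> is the number of integer sequences
  with \<open>0 \<le> \<lambda>\<^sub>1/s\<^sub>1 \<le> \<dots> \<le> \<lambda>\<^sub>m/s\<^sub>m\<close> and \<open>\<lambda>\<^sub>m = s\<^sub>m q - i\<close>; it factors completely.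
\<close>

definition odd_count :: "nat \<Rightarrow> nat \<Rightarrow> int \<Rightarrow> int" where
  "odd_count N i q =
     (if i \<le> N then (q * (2*q+1)) ^ i * ((q+1) * (2*q+1)) ^ (N - i)
      else 2 * q\<^sup>2 * (q * (2*q-1)) ^ (i - N - 1) * (q * (2*q+1)) ^ (2*N - i))"

definition even_count :: "nat \<Rightarrow> nat \<Rightarrow> int \<Rightarrow> int" where
  "even_count N i q =
     (if i = 0 then (q+1) * ((q+1) * (2*q+1)) ^ N
      else if i \<le> 2*N+2 then
        q * (q * (2*q+1)) ^ ((i-1) div 2) * ((q+1) * (2*q+1)) ^ (N - (i-1) div 2)
      else
        q * (q * (2*q-1)) ^ ((i-2*N-2) div 2) * (q * (2*q+1)) ^ (N - (i-2*N-2) div 2))"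

section \<open>Telescoping partial sums of the counts\<close>

text \<open>The subtracted term is \<open>even_count N j q\<close> for \<open>j = 2*k+1\<close> and
  \<open>j = 2*k+2\<close>; its drop from one \<open>k\<close> to the next is the next
  summand.\<close>

lemma sum_odd_count_low:
  "k \<le> N \<Longrightarrow> (\<Sum>i<Suc k. odd_count N i q) =
     (q+1) * ((q+1) * (2*q+1)) ^ N - q * (q * (2*q+1)) ^ k * ((q+1) * (2*q+1)) ^ (N - k)"
proof (induction k)
  case 0
  then show ?case by (simp add: odd_count_def algebra_simps)
next
  case (Suc k)
  then obtain r where r: "N = Suc k + r" by (metis le_Suc_ex)
  define A B where "A = (q * (2*q+1)) ^ k" and "B = ((q+1) * (2*q+1)) ^ r"
  have "(\<Sum>i<Suc (Suc k). odd_count N i q) =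
     (q+1) * ((q+1) * (2*q+1)) ^ N - q * A * (((q+1) * (2*q+1)) * B) + (q * (2*q+1)) * A * B"
    using Suc by (simp add: odd_count_def r A_def B_def)
  also have "\<dots> = (q+1) * ((q+1) * (2*q+1)) ^ N - q * ((q * (2*q+1)) * A) * B"
    by algebra
  finally show ?case by (simp add: r A_def B_def)
qed

text \<open>The case \<open>d = 0\<close> is the low sum at \<open>k = N\<close>. The subtracted
  term is now \<open>even_count N j q\<close> for \<open>j = 2*N+2+2*d\<close> and its
  successor.\<close>

lemma sum_odd_count_high:
  "d \<le> N \<Longrightarrow> (\<Sum>i<Suc N + d. odd_count N i q) =
     (q+1) * ((q+1) * (2*q+1)) ^ N - q * (q * (2*q-1)) ^ d * (q * (2*q+1)) ^ (N - d)"
proof (induction d)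
  case 0
  then show ?case using sum_odd_count_low[of N N q] by simp
next
  case (Suc d)
  then obtain r where r: "N = Suc d + r" by (metis le_Suc_ex)
  define A B where "A = (q * (2*q-1)) ^ d" and "B = (q * (2*q+1)) ^ r"
  have [simp]: "2 * N - Suc (N + d) = r" using r by simp
  have "(\<Sum>i<Suc N + Suc d. odd_count N i q) =
     (q+1) * ((q+1) * (2*q+1)) ^ N - q * A * ((q * (2*q+1)) * B) + 2 * q\<^sup>2 * A * B"
    using Suc by (simp add: odd_count_def A_def B_def) (simp add: r)
  also have "\<dots> = (q+1) * ((q+1) * (2*q+1)) ^ N - q * ((q * (2*q-1)) * A) * B"
    by algebra
  finally show ?case by (simp add: r A_def B_def)
qed

text \<open>The exponents in \<open>even_count\<close> change at every second index, so summands are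
  added in pairs. The subtracted term is \<open>odd_count (Suc N) j q\<close>.\<close>

lemma sum_even_count_low:
  "j \<le> Suc N \<Longrightarrow> (\<Sum>i<2*j. even_count N i q) =
     ((q+1) * (2*q+1)) ^ Suc N - (q * (2*q+1)) ^ j * ((q+1) * (2*q+1)) ^ (Suc N - j)"
proof (induction j)
  case 0
  then show ?case by simp
next
  case (Suc j)
  have two: "(\<Sum>i<2 * Suc j. even_count N i q) =
      (\<Sum>i<2*j. even_count N i q) + even_count N (2*j) q + even_count N (2*j+1) q"
    by simp
  show ?case
  proof (cases j)
    \<comment> \<open>The first pair is separate because index \<open>0\<close> has its own formula
      in \<open>even_count\<close>.\<close>
    case 0
    then show ?thesis unfolding two by (simp add: even_count_def algebra_simps)
  next
    case (Suc u)
    obtain r where r: "N = Suc u + r" using Suc.prems Suc by (metis Suc_le_mono le_Suc_ex)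
    define A B where "A = (q * (2*q+1)) ^ u" and "B = ((q+1) * (2*q+1)) ^ r"
    have e1: "even_count N (2*j) q = q * A * (((q+1) * (2*q+1)) * B)"
      using Suc r by (simp add: even_count_def A_def B_def)
    have e2: "even_count N (2*j+1) q = q * ((q * (2*q+1)) * A) * B"
      using Suc r by (simp add: even_count_def A_def B_def)
    have "(\<Sum>i<2 * Suc j. even_count N i q) =
      ((q+1) * (2*q+1)) ^ Suc N - ((q * (2*q+1)) * A) * (((q+1) * (2*q+1)) * B)
        + q * A * (((q+1) * (2*q+1)) * B) + q * ((q * (2*q+1)) * A) * B"
      unfolding two e1 e2 using Suc.IH Suc.prems by (simp add: Suc r A_def B_def)
    also have "\<dots> = ((q+1) * (2*q+1)) ^ Suc N - ((q * (2*q+1)) * ((q * (2*q+1)) * A)) * B"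
      by algebra
    finally show ?thesis by (simp add: Suc r A_def B_def)
  qed
qed

text \<open>The subtracted term is \<open>odd_count (Suc N) (N+2+d) q\<close>. One extra summand, at
  index \<open>2*N+2\<close>, leads from the low sum to the case \<open>d = 0\<close>.\<close>

lemma sum_even_count_high:
  "d \<le> N \<Longrightarrow> (\<Sum>i<2*N+3+2*d. even_count N i q) =
     ((q+1) * (2*q+1)) ^ Suc N - 2 * q\<^sup>2 * (q * (2*q-1)) ^ d * (q * (2*q+1)) ^ (N - d)"
proof (induction d)
  case 0
  have "(\<Sum>i<2*N+3. even_count N i q) =
      (\<Sum>i<2*Suc N. even_count N i q) + even_count N (2*N+2) q"
    by (simp add: numeral_3_eq_3)
  then show ?case unfolding sum_even_count_low[OF order_refl]
    by (simp add: even_count_def algebra_simps power2_eq_square)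
next
  case (Suc d)
  then obtain r where r: "N = Suc d + r" by (metis le_Suc_ex)
  define A B where "A = (q * (2*q-1)) ^ d" and "B = (q * (2*q+1)) ^ r"
  have "2*N+3+2*Suc d = Suc (Suc (2*N+3+2*d))" by simp
  then have two: "(\<Sum>i<2*N+3+2*Suc d. even_count N i q) =
      (\<Sum>i<2*N+3+2*d. even_count N i q) + even_count N (2*N+3+2*d) q
        + even_count N (2*N+4+2*d) q"
    by (simp add: eval_nat_numeral)
  have v: "(2*N+3+2*d - 2*N - 2) div 2 = d" "(2*N+4+2*d - 2*N - 2) div 2 = Suc d" by auto
  have e1: "even_count N (2*N+3+2*d) q = q * A * ((q * (2*q+1)) * B)"
    unfolding even_count_def v by (simp add: A_def B_def) (simp add: r)
  have e2: "even_count N (2*N+4+2*d) q = q * ((q * (2*q-1)) * A) * B"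
    unfolding even_count_def v by (simp add: A_def B_def) (simp add: r)
  have "(\<Sum>i<2*N+3+2*Suc d. even_count N i q) =
      ((q+1) * (2*q+1)) ^ Suc N - 2 * q\<^sup>2 * A * ((q * (2*q+1)) * B)
        + q * A * ((q * (2*q+1)) * B) + q * ((q * (2*q-1)) * A) * B"
    unfolding two e1 e2 using Suc by (simp add: A_def B_def) (simp add: r)
  also have "\<dots> = ((q+1) * (2*q+1)) ^ Suc N - 2 * q\<^sup>2 * ((q * (2*q-1)) * A) * B"
    by algebra
  finally show ?case by (simp add: r A_def B_def)
qed

text \<open>Combinatorially, both sides count the sequences whose last ratio exceeds
  \<open>q-1\<close> and is at most \<open>q\<close>.\<close>

lemma sum_odd_count:
  "(\<Sum>i<2*N+1. odd_count N i q) = even_count N 0 q - even_count N 0 (q-1)"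
proof -
  have "2*N+1 = Suc N + N" by simp
  then have "(\<Sum>i<2*N+1. odd_count N i q) =
      (q+1) * ((q+1) * (2*q+1)) ^ N - q * (q * (2*q-1)) ^ N"
    using sum_odd_count_high[of N N q] by (simp only: order_refl) simp
  then show ?thesis by (simp add: even_count_def algebra_simps)
qed

lemma sum_even_count:
  "(\<Sum>i<4*N+4. even_count N i q) = odd_count (Suc N) 0 q - odd_count (Suc N) 0 (q-1)"
proof -
  have [simp]: "(4*N+3 - 2*N - 2) div 2 = N" by simp
  have "{..<4*N+4} = insert (4*N+3) {..<2*N+3+2*N}" by auto
  then have "(\<Sum>i<4*N+4. even_count N i q) =
      (\<Sum>i<2*N+3+2*N. even_count N i q) + even_count N (4*N+3) q"
    by simp
  also have "even_count N (4*N+3) q = q * (q * (2*q-1)) ^ N"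
    by (simp add: even_count_def)
  also have "(\<Sum>i<2*N+3+2*N. even_count N i q) + q * (q * (2*q-1)) ^ N
     = ((q+1) * (2*q+1)) ^ Suc N - (q * (2*q-1)) ^ Suc N"
    unfolding sum_even_count_high[OF order_refl]
    by (simp add: algebra_simps power2_eq_square)
  finally show ?thesis by (simp add: odd_count_def algebra_simps)
qed

section \<open>Ascent conditions as thresholds\<close>

text \<open>Here \<open>k\<close> is the ceiling of \<open>j * s / s'\<close>, so
  \<open>i / s < j / s'\<close> cuts out an initial segment of indices.\<close>

lemma less_threshold_iff:
  fixes i j k s s' :: nat
  assumes "j * s \<le> k * s'" "k * s' < j * s + s'"
  shows "i * s' < j * s \<longleftrightarrow> i < k"
proof
  assume "i * s' < j * s"
  then have "i * s' < k * s'" using assms by linarith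
  then show "i < k" by simp
next
  assume "i < k"
  then have "Suc i * s' \<le> k * s'" by (intro mult_right_mono) auto
  then show "i * s' < j * s" using assms by simp
qed

text \<open>Raising the bound on the last ratio from \<open>q - j/(4*N+4)\<close> to
  \<open>q\<close> admits exactly the sequences with \<open>i/(2*N+1) < j/(4*N+4)\<close>.\<close>

lemma odd_to_even:
  assumes "j < 4*N+4"
  shows "(\<Sum>i | i < 2*N+1 \<and> i * (4*N+4) < j * (2*N+1). odd_count N i q)
           = even_count N 0 q - even_count N j q"
proof -
  consider "j = 0" | "j > 0" "j \<le> 2*N+2" | "j > 2*N+2" by linarith
  then show ?thesis
  proof cases
    case 1
    then show ?thesis by simp
  next
    case 2
    define u where "u = (j-1) div 2"
    have u: "u \<le> N" "j = 2*u+1 \<or> j = 2*u+2" using 2 by (auto simp: u_def)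
    then have T: "i * (4*N+4) < j * (2*N+1) \<longleftrightarrow> i < Suc u" for i
      by (intro less_threshold_iff; elim disjE; simp add: algebra_simps)
    have "{i. i < 2*N+1 \<and> i * (4*N+4) < j * (2*N+1)} = {..<Suc u}"
      unfolding T using u(1) by auto
    then show ?thesis using 2 sum_odd_count_low[OF u(1)] by (simp add: even_count_def u_def)
  next
    case 3
    define v where "v = (j-2*N-2) div 2"
    have v: "v \<le> N" "j = 2*(Suc N+v) \<or> j = 2*(Suc N + v)+1"
      using 3 assms by (auto simp: v_def)
    then have T: "i * (4*N+4) < j * (2*N+1) \<longleftrightarrow> i < Suc N + v" for i
      by (intro less_threshold_iff; elim disjE; simp add: algebra_simps)
    have "{i. i < 2*N+1 \<and> i * (4*N+4) < j * (2*N+1)} = {..<Suc N + v}"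
      unfolding T using v(1) by auto
    then show ?thesis using 3 sum_odd_count_high[OF v(1)] by (simp add: even_count_def v_def)
  qed
qed

lemma even_to_odd:
  assumes "j < 2*N+3"
  shows "(\<Sum>i | i < 4*N+4 \<and> i * (2*N+3) < j * (4*N+4). even_count N i q)
           = odd_count (Suc N) 0 q - odd_count (Suc N) j q"
\<comment> \<open>The threshold is the ceiling of \<open>2*j - 2*j/(2*N+3)\<close>: it is
  \<open>2*j\<close> up to \<open>j = Suc N\<close> and \<open>2*j - 1\<close> afterwards.\<close>
proof (cases "j \<le> Suc N")
  case True
  then have T: "i * (2*N+3) < j * (4*N+4) \<longleftrightarrow> i < 2*j" for i
    by (intro less_threshold_iff; simp add: algebra_simps)
  have "{i. i < 4*N+4 \<and> i * (2*N+3) < j * (4*N+4)} = {..<2*j}"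
    unfolding T using True by auto
  then show ?thesis using True sum_even_count_low[OF True] by (simp add: odd_count_def)
next
  case False
  define d where "d = j - N - 2"
  have d: "d \<le> N" "j = N + 2 + d" using False assms by (auto simp: d_def)
  then have T: "i * (2*N+3) < j * (4*N+4) \<longleftrightarrow> i < 2*N+3+2*d" for i
    by (intro less_threshold_iff; simp add: algebra_simps)
  have "{i. i < 4*N+4 \<and> i * (2*N+3) < j * (4*N+4)} = {..<2*N+3+2*d}"
    unfolding T using d(1) by auto
  moreover have "2 * Suc N - j = N - d" "j - Suc N - 1 = d" using d by auto
  ultimately show ?thesis using False sum_even_count_high[OF d(1)]
    by (simp add: odd_count_def)
qed

section \<open>Generating functions by last entry\<close>

text \<open>At coefficient \<open>q > 0\<close> the shifted terms give
  \<open>b 0 (q-1) - b j (q-1)\<close> and the others \<open>b j q - b 0 (q-1)\<close>, so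
  \<open>b 0\<close> cancels. At \<open>q = 0\<close> there are no shifted terms, and
  \<open>zero\<close> takes care of \<open>b 0 (-1)\<close>.\<close>

lemma fps_transfer_step:
  fixes a b :: "nat \<Rightarrow> int \<Rightarrow> int"
  assumes part: "\<And>q. (\<Sum>i | i < s \<and> P i. a i q) = b 0 q - b j q"
    and total: "\<And>q. (\<Sum>i<s. a i q) = b 0 q - b 0 (q-1)"
    and zero: "b 0 (-1) = 0"
  shows "(\<Sum>i<s. (if P i then fps_X else 1) * Abs_fps (\<lambda>q. a i (int q)))
           = (1 - fps_X) * Abs_fps (\<lambda>q. b j (int q))"
proof (rule fps_ext)
  fix q
  have split: "(\<Sum>i<s. a i r) = (\<Sum>i | i < s \<and> P i. a i r) + (\<Sum>i | i < s \<and> \<not> P i. a i r)" for r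
    using sum.If_cases[of "{..<s}" P "\<lambda>i. a i r" "\<lambda>i. a i r"]
    by (simp add: Collect_conj_eq lessThan_def Collect_neg_eq)
  have rest: "(\<Sum>i | i < s \<and> \<not> P i. a i r) = b j r - b 0 (r-1)" for r
    using split[of r] part[of r] total[of r] by simp
  have "fps_nth (\<Sum>i<s. (if P i then fps_X else 1) * Abs_fps (\<lambda>q. a i (int q))) q
      = (\<Sum>i<s. if P i then (if q = 0 then 0 else a i (int (q-1))) else a i (int q))"
    by (auto simp: fps_sum_nth intro!: sum.cong)
  also have "\<dots> = (\<Sum>i | i < s \<and> P i. if q = 0 then 0 else a i (int (q-1)))
      + (\<Sum>i | i < s \<and> \<not> P i. a i (int q))"
    by (simp add: sum.If_cases Collect_conj_eq lessThan_def Collect_neg_eq)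
  also have "\<dots> = fps_nth ((1 - fps_X) * Abs_fps (\<lambda>q. b j (int q))) q"
    using zero by (cases q) (auto simp: part rest left_diff_distrib)
  finally show "fps_nth (\<Sum>i<s. (if P i then fps_X else 1) * Abs_fps (\<lambda>q. a i (int q))) q
    = fps_nth ((1 - fps_X) * Abs_fps (\<lambda>q. b j (int q))) q" .
qed

definition last_gf :: "(nat \<Rightarrow> nat) \<Rightarrow> nat \<Rightarrow> nat \<Rightarrow> int fps" where
  "last_gf s m i = (\<Sum>e | e \<in> inv_seqs s m \<and> last e = i. fps_X ^ asc s e)"

lemma inv_seqs_snoc:
  "{e \<in> inv_seqs s (Suc m). last e = j} = 
    (if j < s (Suc m) then (\<lambda>e. e @ [j]) ` inv_seqs s m else {})"
proof -
  have mem: "e @ [k] \<in> inv_seqs s (Suc m) \<longleftrightarrow> e \<in> inv_seqs s m \<and> k < s (Suc m)" for e k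
  proof -
    have "(\<forall>i\<in>{1..Suc m}. (e @ [k]) ! (i-1) < s i) \<longleftrightarrow>
        (\<forall>i\<in>{1..m}. e ! (i-1) < s i) \<and> k < s (Suc m)" if "length e = m"
      using that by (auto simp: nth_append atLeastAtMostSuc_conv)
    then show ?thesis by (auto simp: inv_seqs_def)
  qed
  have ex: "\<exists>e' k. e = e' @ [k]" if "e \<in> inv_seqs s (Suc m)" for e
    using that by (cases e rule: rev_cases) (auto simp: inv_seqs_def)
  show ?thesis using ex mem by (fastforce split: if_splits)
qed

text \<open>As \<open>m > 0\<close>, the new comparison involves \<open>s m\<close> itself and not
  the convention at index \<open>0\<close>; cross-multiplication makes it integral.\<close>

lemma asc_snoc:
  assumes e: "e \<in> inv_seqs s m" and m: "m > 0" and pos: "s m > 0" "s (Suc m) > 0"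
  shows "asc s (e @ [j]) = asc s e + (if last e * s (Suc m) < j * s m then 1 else 0)"
proof -
  have len: "length e = m" using e by (simp add: inv_seqs_def)
  let ?Q = "\<lambda>e i. real ((0 # e) ! i) / real ((s(0 := 1)) i)
       < real ((0 # e) ! (i + 1)) / real ((s(0 := 1)) (i + 1))"
  have old: "?Q (e @ [j]) i \<longleftrightarrow> ?Q e i" if "i < m" for i
    using that len by (cases i) (auto simp: nth_append)
  have last: "(0 # e @ [j]) ! m = last e"
    using len m by (cases e rule: rev_cases) (auto simp: nth_append)
  have "?Q (e @ [j]) m \<longleftrightarrow> real (last e) / real (s m) < real j / real (s (Suc m))"
    using len m last by (simp add: nth_append)
  also have "\<dots> \<longleftrightarrow> real (last e * s (Suc m)) < real (j * s m)"
    using pos by (simp add: field_simps)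
  finally have new: "?Q (e @ [j]) m \<longleftrightarrow> last e * s (Suc m) < j * s m"
    by (simp only: of_nat_less_iff)
  have "{i. i < length (e @ [j]) \<and> ?Q (e @ [j]) i} =
      {i. i < length e \<and> ?Q e i} \<union> (if last e * s (Suc m) < j * s m then {m} else {})"
    using old new len by (auto simp: less_Suc_eq simp del: fun_upd_apply)
  then show ?thesis unfolding asc_def
    using len by (auto simp: card_insert_if simp del: fun_upd_apply)
qed

lemma last_gf_Suc:
  assumes m: "m > 0" and pos: "s m > 0" and j: "j < s (Suc m)"
  shows "last_gf s (Suc m) j =
    (\<Sum>i<s m. (if i * s (Suc m) < j * s m then fps_X else 1) * last_gf s m i)"
proof -
  have last: "last e < s m" if "e \<in> inv_seqs s m" for e
  proof -
    have "length e = m" "e ! (m - 1) < s m" using that m by (auto simp: inv_seqs_def)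
    then show ?thesis using m by (cases e rule: rev_cases) auto
  qed
  have "last_gf s (Suc m) j = (\<Sum>e\<in>inv_seqs s m. fps_X ^ asc s (e @ [j]))"
    unfolding last_gf_def inv_seqs_snoc using j by (simp add: sum.reindex inj_on_def)
  also have "\<dots> = (\<Sum>e\<in>inv_seqs s m.
      (if last e * s (Suc m) < j * s m then fps_X else 1) * fps_X ^ asc s e)"
    using j by (intro sum.cong refl) (simp add: asc_snoc[where m = m] m pos)
  also have "\<dots> = (\<Sum>i<s m. \<Sum>e | e \<in> inv_seqs s m \<and> last e = i.
      (if last e * s (Suc m) < j * s m then fps_X else 1) * fps_X ^ asc s e)"
    using last by (intro sum.group[symmetric]) (auto simp: finite_inv_seqs)
  also have "\<dots> = (\<Sum>i<s m. (if i * s (Suc m) < j * s m then fps_X else 1) * last_gf s m i)"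
    unfolding last_gf_def sum_distrib_left by (intro sum.cong) auto
  finally show ?thesis .
qed

text \<open>A final entry \<open>0\<close> never creates an ascent.\<close>

lemma last_gf_total:
  assumes m: "m > 0" and pos: "s m > 0" "s (Suc m) > 0"
  shows "last_gf s (Suc m) 0 = (\<Sum>e\<in>inv_seqs s m. fps_X ^ asc s e)"
  unfolding last_gf_def inv_seqs_snoc using pos
  by (simp add: sum.reindex inj_on_def asc_snoc[where m = m] m pos)

text \<open>The induction step shared by both parities; each new entry contributes one factor
  \<open>1 - fps_X\<close>.\<close>

lemma last_gf_step:
  assumes m: "m > 0" and s: "s m = S" "s (Suc m) = T" "S > 0" and j: "j < T"
    and a: "\<And>i. i < S \<Longrightarrow> last_gf s m i = (1 - fps_X) ^ m * Abs_fps (\<lambda>q. a i (int q))"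
    and part: "\<And>q. (\<Sum>i | i < S \<and> i * T < j * S. a i q) = b 0 q - b j q"
    and total: "\<And>q. (\<Sum>i<S. a i q) = b 0 q - b 0 (q-1)"
    and zero: "b 0 (-1) = 0"
  shows "last_gf s (Suc m) j = (1 - fps_X) ^ Suc m * Abs_fps (\<lambda>q. b j (int q))"
proof -
  have "last_gf s (Suc m) j =
      (\<Sum>i<S. (if i * T < j * S then fps_X else 1) * last_gf s m i)"
    using last_gf_Suc[of m s j] m s j by simp
  also have "\<dots> = (1 - fps_X) ^ m *
      (\<Sum>i<S. (if i * T < j * S then fps_X else 1) * Abs_fps (\<lambda>q. a i (int q)))"
    unfolding sum_distrib_left by (intro sum.cong refl) (simp add: a)
  also have "\<dots> = (1 - fps_X) ^ m * ((1 - fps_X) * Abs_fps (\<lambda>q. b j (int q)))"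
    by (simp only: fps_transfer_step[OF part total zero])
  finally show ?thesis by (simp add: mult_ac)
qed

text \<open>The odd-length formula is an assumption here, so that this half step can be used inside
  the induction proving that formula.\<close>

lemma last_gf_even_step:
  assumes odd: "\<And>i. i < 2*N+1 \<Longrightarrow> last_gf s_seq (2*N+1) i =
      (1 - fps_X) ^ (2*N+1) * Abs_fps (\<lambda>q. odd_count N i (int q))"
    and j: "j < 4*N+4"
  shows "last_gf s_seq (Suc (2*N+1)) j =
      (1 - fps_X) ^ Suc (2*N+1) * Abs_fps (\<lambda>q. even_count N j (int q))"
  by (rule last_gf_step[where S = "2*N+1" and T = "4*N+4"
        and a = "odd_count N" and b = "even_count N", OF _ _ _ _ j odd odd_to_even[OF j] sum_odd_count])
     (auto simp: s_seq_def even_count_def)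

lemma last_gf_odd:
  "i < 2*N+1 \<Longrightarrow> last_gf s_seq (2*N+1) i =
      (1 - fps_X) ^ (2*N+1) * Abs_fps (\<lambda>q. odd_count N i (int q))"
proof (induction N arbitrary: i)
  case 0
  have "{e. e \<in> inv_seqs s_seq (Suc 0) \<and> last e = 0} = {[0]}"
    by (auto simp: inv_seqs_def s_seq_def length_Suc_conv)
  moreover have "asc s_seq [0] = 0" by (simp add: asc_def)
  moreover have "(1 - fps_X) * Abs_fps (\<lambda>q. 1::int) = 1"
    by (rule fps_ext) (simp add: left_diff_distrib)
  ultimately show ?case using 0 by (simp add: last_gf_def odd_count_def)
next
  case (Suc N)
  have j: "i < 2*N+3" using Suc.prems by simp
  have "last_gf s_seq (Suc (Suc (2*N+1))) i =
      (1 - fps_X) ^ Suc (Suc (2*N+1)) * Abs_fps (\<lambda>q. odd_count (Suc N) i (int q))"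
    by (rule last_gf_step[where S = "4*N+4" and T = "2*N+3"
          and a = "even_count N" and b = "odd_count (Suc N)",
          OF _ _ _ _ j last_gf_even_step[OF Suc.IH] even_to_odd[OF j] sum_even_count])
       (auto simp: s_seq_def odd_count_def)
  then show ?case by simp
qed

lemma inv_seqs_gf:
  "(\<Sum>e\<in>I (2*N+1). fps_X ^ asc s_seq e) = (1 - fps_X) ^ (2*N+2) *
     Abs_fps (\<lambda>t. (int t + 1) * ((int t + 1) * (2 * int t + 1)) ^ N)"
proof -
  have "(\<Sum>e\<in>I (2*N+1). fps_X ^ asc s_seq e) = last_gf s_seq (Suc (2*N+1)) 0"
    unfolding I_def by (rule last_gf_total[symmetric]) (auto simp: s_seq_def)
  also have "\<dots> = (1 - fps_X) ^ Suc (2*N+1) * Abs_fps (\<lambda>q. even_count N 0 (int q))"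
    by (rule last_gf_even_step) (use last_gf_odd in auto)
  finally show ?thesis by (simp add: even_count_def)
qed

section \<open>Signed permutations\<close>

text \<open>
  A list of pairs \<^term>\<open>(c, z)\<close> places the letter \<^term>\<open>z\<close> in compartment \<^term>\<open>c\<close> of a word cut by
  \<^term>\<open>t\<close> bars. Lexicographic sortedness says that every descent is crossed by a bar, and the final
  sentinel \<^term>\<open>(t, 0)\<close> encodes the convention that a positive last letter is a descent.
\<close>

definition barred :: "int list \<Rightarrow> nat \<Rightarrow> (nat \<times> int) list set" where
  "barred \<sigma> t = {xs. map snd xs = \<sigma> \<and> sorted (xs @ [(t, 0)])}"

text \<open>This is the effect of inserting one more bar in front of the word.\<close>

abbreviation raise :: "(nat \<times> int) list \<Rightarrow> (nat \<times> int) list" where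
  "raise \<equiv> map (\<lambda>(c, z). (Suc c, z))"

lemma inj_raise: "inj raise"
  by (rule inj_mapI) (auto simp: inj_on_def)

lemma sorted_raise [simp]: "sorted (raise xs) \<longleftrightarrow> sorted xs"
  by (induction xs) auto

lemma raise_mem_barred [simp]: "raise xs \<in> barred \<sigma> (Suc t) \<longleftrightarrow> xs \<in> barred \<sigma> t"
proof -
  have "raise xs @ [(Suc t, 0)] = raise (xs @ [(t, 0)])" by simp
  then have "sorted (raise xs @ [(Suc t, 0)]) \<longleftrightarrow> sorted (xs @ [(t, 0)])"
    by (simp only: sorted_raise)
  moreover have "map snd (raise xs) = map snd xs" by auto
  ultimately show ?thesis unfolding barred_def by (simp only: mem_Collect_eq)
qed

lemma sorted_positive_imp_raise:
  assumes "sorted xs" "xs \<noteq> [] \<Longrightarrow> fst (hd xs) > 0"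
  shows "\<exists>ys. xs = raise ys"
proof
  have "fst p > 0" if "p \<in> set xs" for p
    using assms that by (cases xs) (auto simp: less_eq_prod_def)
  then show "xs = raise (map (\<lambda>(c, z). (c - 1, z)) xs)"
    by (auto simp: comp_def case_prod_beta intro!: map_idI[symmetric] prod_eqI)
qed

lemma barred_Cons_mem:
  "(0, z) # xs \<in> barred (z # \<tau>) t \<longleftrightarrow>
     xs \<in> barred \<tau> t \<and> (z \<le> hd (\<tau> @ [0]) \<or> fst (hd (xs @ [(t, 0)])) > 0)"
proof (cases xs)
  case (Cons p ys)
  have "(0, z) # xs \<in> barred (z # \<tau>) t \<longleftrightarrow> xs \<in> barred \<tau> t \<and> (0, z) \<le> p"
    unfolding Cons barred_def by (auto simp del: less_eq_prod_simp intro: order_trans)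
  then show ?thesis using Cons by (cases p) (auto simp: barred_def)
qed (auto simp: barred_def)

lemma barred_positive:
  assumes "xs \<in> barred \<tau> t" "fst (hd (xs @ [(t, 0)])) > 0"
  obtains u ys where "t = Suc u" "xs = raise ys" "ys \<in> barred \<tau> u"
proof -
  have st: "sorted (xs @ [(t, 0)])" using assms by (simp add: barred_def)
  obtain ys where ys: "xs = raise ys"
    using sorted_positive_imp_raise[of xs] st assms(2) by (cases "xs = []") (auto simp: sorted_append)
  have "t > 0" using st assms(2) by (cases xs) auto
  then obtain u where "t = Suc u" by (cases t) auto
  with ys assms(1) show ?thesis using that by simp
qed

lemma hd_raise: "fst (hd (raise xs @ [(Suc t, 0)])) > 0"
  by (cases xs) auto

text \<open>If the first letter lies behind a bar, undoing \<open>raise\<close> removes that bar.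
  Otherwise it lies in compartment \<open>0\<close>, and a descent after it forces a bar directly
  behind it.\<close>

lemma barred_Cons:
  "barred (z # \<tau>) t =
     (if t = 0 then {} else raise ` barred (z # \<tau>) (t - 1)) \<union>
     (Cons (0, z)) ` (if z \<le> hd (\<tau> @ [0]) then barred \<tau> t
                     else if t = 0 then {} else raise ` barred \<tau> (t - 1))"
  (is "_ = ?R \<union> ?L")
proof (intro set_eqI iffI)
  fix xs assume xs: "xs \<in> barred (z # \<tau>) t"
  then obtain c ys where c: "xs = (c, z) # ys" by (auto simp: barred_def)
  show "xs \<in> ?R \<union> ?L"
  proof (cases "c = 0")
    case True
    have ys: "ys \<in> barred \<tau> t" "z \<le> hd (\<tau> @ [0]) \<or> fst (hd (ys @ [(t, 0)])) > 0"
      using xs barred_Cons_mem unfolding c True by auto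
    have "(0, z) # ys \<in> ?L"
    proof (cases "z \<le> hd (\<tau> @ [0])")
      case False
      with ys(2) have "fst (hd (ys @ [(t, 0)])) > 0" by simp
      from barred_positive[OF ys(1) this] obtain u ys'
        where "t = Suc u" "ys = raise ys'" "ys' \<in> barred \<tau> u" .
      with False show ?thesis by simp
    qed (use ys in auto)
    then show ?thesis unfolding c True by simp
  next
    case False
    then have "fst (hd (xs @ [(t, 0)])) > 0" using c by simp
    from barred_positive[OF xs this] obtain u ys
      where "t = Suc u" "xs = raise ys" "ys \<in> barred (z # \<tau>) u" .
    then show ?thesis by simp
  qed
next
  fix xs assume "xs \<in> ?R \<union> ?L"
  then show "xs \<in> barred (z # \<tau>) t"
    by (cases t) (auto simp: barred_Cons_mem hd_raise split: if_splits)
qed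

lemma barred_Nil: "barred [] t = {[]}"
  by (auto simp: barred_def)

lemma finite_barred: "finite (barred \<sigma> t)"
proof (induction \<sigma> arbitrary: t)
  case Nil
  then show ?case by (simp add: barred_Nil)
next
  case (Cons z \<tau>)
  show ?case
  proof (induction t)
    case 0
    then show ?case by (subst barred_Cons) (simp add: Cons.IH)
  next
    case (Suc t)
    then show ?case by (subst barred_Cons) (simp add: Cons.IH)
  qed
qed

lemma card_barred_Cons:
  "card (barred (z # \<tau>) t) =
     (if t = 0 then 0 else card (barred (z # \<tau>) (t - 1))) +
     (if z \<le> hd (\<tau> @ [0]) then card (barred \<tau> t)
      else if t = 0 then 0 else card (barred \<tau> (t - 1)))"
proof -
  have inj: "card (raise ` A) = card A" "card (Cons p ` A) = card A" for A and p :: "nat \<times> int"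
    by (auto intro!: card_image inj_on_subset[OF inj_raise] simp: inj_on_def)
  show ?thesis
    by (subst barred_Cons, subst card_Un_disjoint) (auto simp: finite_barred inj)
qed

section \<open>Descents and the series of barred words\<close>

lemma des_B_Nil: "des_B [] = 0"
  by (simp add: des_B_def Des_B_def)

lemma des_B_Cons: "des_B (z # \<tau>) = des_B \<tau> + (if z \<le> hd (\<tau> @ [0]) then 0 else 1)"
proof -
  \<comment> \<open>The trailing \<open>0\<close> turns a positive last letter into an ordinary
    descent.\<close>
  have D: "Des_B \<sigma> = {i. 1 \<le> i \<and> i \<le> length \<sigma> \<and> (\<sigma> @ [0]) ! (i - 1) > (\<sigma> @ [0]) ! i}" for \<sigma>
    by (cases "\<sigma> = []") (auto simp: Des_B_def nth_append Suc_le_eq)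
  have "i \<in> Des_B (z # \<tau>) \<longleftrightarrow>
      i \<in> Suc ` Des_B \<tau> \<union> (if z \<le> hd (\<tau> @ [0]) then {} else {1})" for i
  proof -
    consider "i = 0" | "i = 1" | k where "i = Suc (Suc k)"
      by (metis One_nat_def not0_implies_Suc)
    then show ?thesis
    proof cases
      case 2
      have "(\<tau> @ [0]) ! 0 = hd (\<tau> @ [0])" by (simp add: hd_conv_nth)
      then show ?thesis using 2 by (auto simp: D)
    qed (auto simp: D)
  qed
  then have "Des_B (z # \<tau>) = Suc ` Des_B \<tau> \<union> (if z \<le> hd (\<tau> @ [0]) then {} else {1})"
    by blast
  moreover have "finite (Des_B \<tau>)"
    by (rule finite_subset[of _ "{..length \<tau>}"]) (auto simp: D)
  moreover have "1 \<notin> Suc ` Des_B \<tau>" by (auto simp: D)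
  ultimately show ?thesis by (auto simp: des_B_def card_image)
qed

text \<open>By \<open>card_barred_Cons\<close>, a factor \<open>1 - fps_X\<close> strips the first
  letter and leaves \<open>fps_X\<close> exactly when that letter starts a descent.\<close>

lemma barred_gf:
  "fps_X ^ des_B \<sigma> =
     (1 - fps_X) ^ Suc (length \<sigma>) * Abs_fps (\<lambda>t. int (card (barred \<sigma> t)))"
proof (induction \<sigma>)
  case Nil
  have "(1 - fps_X) * Abs_fps (\<lambda>t. 1::int) = 1"
    by (rule fps_ext) (simp add: left_diff_distrib)
  then show ?case by (simp add: des_B_Nil barred_Nil)
next
  case (Cons z \<tau>)
  have "(1 - fps_X) * Abs_fps (\<lambda>t. int (card (barred (z # \<tau>) t))) =
      (if z \<le> hd (\<tau> @ [0]) then 1 else fps_X) * Abs_fps (\<lambda>t. int (card (barred \<tau> t)))"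
    proof (rule fps_ext)
    fix t
    show "fps_nth ((1 - fps_X) * Abs_fps (\<lambda>t. int (card (barred (z # \<tau>) t)))) t =
      fps_nth ((if z \<le> hd (\<tau> @ [0]) then 1 else fps_X) *
        Abs_fps (\<lambda>t. int (card (barred \<tau> t)))) t"
      using card_barred_Cons[of z \<tau> t] by (simp add: left_diff_distrib)
  qed
  then have "(1 - fps_X) ^ Suc (length (z # \<tau>)) * Abs_fps (\<lambda>t. int (card (barred (z # \<tau>) t)))
      = (if z \<le> hd (\<tau> @ [0]) then 1 else fps_X) *
        ((1 - fps_X) ^ Suc (length \<tau>) * Abs_fps (\<lambda>t. int (card (barred \<tau> t))))"
    by (simp add: mult_ac)
  also have "\<dots> = fps_X ^ des_B (z # \<tau>)"
    unfolding Cons.IH[symmetric] by (simp add: des_B_Cons)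
  finally show ?case by simp
qed

section \<open>Counting multisets with prescribed image\<close>

text \<open>For barred words, \<open>S\<close> holds the admissible pairs, \<open>g\<close> takes
  the absolute value of the letter, and \<open>M\<close> is the multiset being permuted.\<close>

definition lifts :: "'a set \<Rightarrow> ('a \<Rightarrow> 'b) \<Rightarrow> 'b multiset \<Rightarrow> 'a multiset set" where
  "lifts S g M = {A. set_mset A \<subseteq> S \<and> image_mset g A = M}"

text \<open>As the supports are disjoint, filtering by \<open>g x \<in># M\<close> recovers the part
  over \<open>M\<close>, so each lift splits uniquely.\<close>

lemma card_lifts_union:
  assumes "set_mset M \<inter> set_mset N = {}"
  shows "card (lifts S g (M + N)) = card (lifts S g M) * card (lifts S g N)"
proof -
  have "lifts S g (M + N) = (\<lambda>(A, B). A + B) ` (lifts S g M \<times> lifts S g N)"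
  proof (intro set_eqI iffI)
    fix A assume A: "A \<in> lifts S g (M + N)"
    then obtain B C where "A = B + C" "image_mset g B = M" "image_mset g C = N"
      using image_mset_eq_plusD[of g A M N] by (auto simp: lifts_def)
    with A show "A \<in> (\<lambda>(A, B). A + B) ` (lifts S g M \<times> lifts S g N)"
      by (auto simp: lifts_def)
  qed (auto simp: lifts_def)
  moreover have "inj_on (\<lambda>(A, B). A + B) (lifts S g M \<times> lifts S g N)"
  proof -
    have fil: "filter_mset (\<lambda>x. g x \<in># M) (A + B) = A"
      if "A \<in> lifts S g M" "B \<in> lifts S g N" for A B
    proof -
      have "filter_mset (\<lambda>x. g x \<in># M) A = A"
        using that(1) by (auto simp: lifts_def filter_mset_eq_conv)
      moreover have "filter_mset (\<lambda>x. g x \<in># M) B = {#}"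
        using that(2) assms by (auto simp: lifts_def filter_mset_eq_conv)
      ultimately show ?thesis by simp
    qed
    show ?thesis
    proof (rule inj_onI, clarify)
      fix A B A' B'
      assume m: "A \<in> lifts S g M" "B \<in> lifts S g N" "A' \<in> lifts S g M" "B' \<in> lifts S g N"
        and eq: "A + B = A' + B'"
      have "A = A'" using fil[OF m(1,2)] fil[OF m(3,4)] eq by simp
      with eq show "A = A' \<and> B = B'" by simp
    qed
  qed
  ultimately show ?thesis by (simp add: card_image card_cartesian_product)
qed

lemma card_lifts_single: "card (lifts S g {#k#}) = card {p \<in> S. g p = k}"
proof -
  have "lifts S g {#k#} = (\<lambda>p. {#p#}) ` {p \<in> S. g p = k}"
    by (auto simp: lifts_def dest!: msed_map_invR)
  then show ?thesis by (simp add: card_image inj_on_def)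
qed

text \<open>The multisets gained with a new \<open>x\<close> are \<open>{#x, y#}\<close> with
  \<open>y\<close> in \<open>insert x Q\<close>. Doubling the count avoids a division.\<close>

lemma card_multisets_size_2:
  "finite Q \<Longrightarrow> finite {A. set_mset A \<subseteq> Q \<and> size A = 2} \<and>
     2 * card {A. set_mset A \<subseteq> Q \<and> size A = 2} = card Q * (card Q + 1)"
proof (induction Q rule: finite_induct)
  case empty
  have "{A :: 'a multiset. A = {#} \<and> size A = 2} = {}" by auto
  then show ?case by simp
next
  case (insert x Q)
  let ?P = "\<lambda>Q. {A. set_mset A \<subseteq> Q \<and> size A = 2}"
  have eq: "?P (insert x Q) = ?P Q \<union> (\<lambda>y. {#x, y#}) ` insert x Q"
  proof (intro set_eqI iffI)
    fix A assume A: "A \<in> ?P (insert x Q)"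
    show "A \<in> ?P Q \<union> (\<lambda>y. {#x, y#}) ` insert x Q"
    proof (cases "x \<in># A")
      case True
      then obtain B where B: "A = add_mset x B" by (metis multi_member_split)
      then have "size B = 1" using A by simp
      then obtain y where "B = {#y#}" using size_1_singleton_mset by auto
      then show ?thesis using A B by auto
    next
      case False
      then show ?thesis using A by auto
    qed
  qed auto
  have inj: "inj_on (\<lambda>y. {#x, y#}) (insert x Q)" by (auto simp: inj_on_def)
  have disj: "?P Q \<inter> (\<lambda>y. {#x, y#}) ` insert x Q = {}" using insert by auto
  have "card (?P (insert x Q)) = card (?P Q) + Suc (card Q)"
    unfolding eq using insert disj card_image[OF inj] by (subst card_Un_disjoint) auto
  moreover have "finite (?P (insert x Q))" unfolding eq using insert by auto
  ultimately show ?case using insert by (simp add: algebra_simps)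
qed

lemma card_lifts_double:
  assumes "finite {p \<in> S. g p = k}" "card {p \<in> S. g p = k} = 2 * t + 1"
  shows "card (lifts S g (replicate_mset 2 k)) = (t + 1) * (2 * t + 1)"
proof -
  have "lifts S g (replicate_mset 2 k) = {A. set_mset A \<subseteq> {p \<in> S. g p = k} \<and> size A = 2}"
  proof (intro set_eqI iffI)
    fix A assume A: "A \<in> lifts S g (replicate_mset 2 k)"
    then have img: "image_mset g A = replicate_mset 2 k" by (simp add: lifts_def)
    have "size A = 2" using arg_cong[OF img, of size] by simp
    moreover have "g ` set_mset A = {k}" using arg_cong[OF img, of set_mset] by simp
    ultimately show "A \<in> {A. set_mset A \<subseteq> {p \<in> S. g p = k} \<and> size A = 2}"
      using A by (auto simp: lifts_def)
  next
    fix A assume A: "A \<in> {A. set_mset A \<subseteq> {p \<in> S. g p = k} \<and> size A = 2}"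
    then have "image_mset g A = image_mset (\<lambda>_. k) A" by (intro image_mset_cong) auto
    with A show "A \<in> lifts S g (replicate_mset 2 k)"
      by (auto simp: lifts_def image_mset_const_eq)
  qed
  with card_multisets_size_2[OF assms(1)] assms(2) show ?thesis by simp
qed

text \<open>
  Since the letter of absolute value \<^term>\<open>n\<close> is unique, requiring it to be negative amounts to
  forbidding the pairs that carry \<^term>\<open>int n\<close>.
\<close>

definition slots :: "nat \<Rightarrow> nat \<Rightarrow> (nat \<times> int) set" where
  "slots t n = {p. p \<le> (t, 0) \<and> snd p \<noteq> int n}"

abbreviation letter :: "nat \<times> int \<Rightarrow> nat" where
  "letter p \<equiv> nat \<bar>snd p\<bar>"

text \<open>Below the sentinel \<open>(t, 0)\<close> the letter \<open>- int k\<close> may use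
  compartments \<open>0\<close> to \<open>t\<close>, but \<open>int k\<close> only those before
  \<open>t\<close>.\<close>

lemma slots_double:
  assumes "0 < k" "k < n"
  shows "finite {p \<in> slots t n. letter p = k}" "card {p \<in> slots t n. letter p = k} = 2 * t + 1"
proof -
  have eq: "{p \<in> slots t n. letter p = k} = {..t} \<times> {- int k} \<union> {..<t} \<times> {int k}"
    using assms by (auto simp: slots_def)
  show "finite {p \<in> slots t n. letter p = k}" unfolding eq by simp
  show "card {p \<in> slots t n. letter p = k} = 2 * t + 1" unfolding eq
    using assms by (subst card_Un_disjoint) (auto simp: card_cartesian_product)
qed

lemma slots_single:
  assumes "0 < n"
  shows "card {p \<in> slots t n. letter p = n} = t + 1"
proof -
  have "{p \<in> slots t n. letter p = n} = {..t} \<times> {- int n}"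
    using assms by (auto simp: slots_def)
  then show ?thesis by (simp add: card_cartesian_product)
qed

lemma card_lifts_doubles:
  "k < n \<Longrightarrow> card (lifts (slots t n) letter (\<Sum>i\<in>{1..<Suc k}. replicate_mset 2 i))
     = ((t + 1) * (2 * t + 1)) ^ k"
proof (induction k)
  case 0
  have "lifts (slots t n) letter {#} = {{#}}" by (auto simp: lifts_def)
  then show ?case by simp
next
  case (Suc k)
  have "(\<Sum>i\<in>{1..<Suc (Suc k)}. replicate_mset 2 i) =
      (\<Sum>i\<in>{1..<Suc k}. replicate_mset 2 i) + replicate_mset 2 (Suc k)"
    by (simp add: sum.atLeastLessThan_Suc)
  moreover have "set_mset (\<Sum>i\<in>{1..<Suc k}. replicate_mset 2 i)
      \<inter> set_mset (replicate_mset 2 (Suc k)) = {}"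
    by (auto simp: set_mset_sum)
  ultimately show ?case
    using Suc card_lifts_double[OF slots_double[of "Suc k" n t]]
    by (simp only: card_lifts_union) (simp add: mult_ac)
qed

section \<open>Enumeration of barred words over \<open>V n\<close>\<close>

lemma V_iff:
  assumes n: "n > 0"
  shows "\<sigma> \<in> V n \<longleftrightarrow> image_mset (\<lambda>z. nat \<bar>z\<bar>) (mset \<sigma>) = (\<Sum>i\<in>{1..<n}. replicate_mset 2 i) + {#n#}
     \<and> int n \<notin> set \<sigma>"
proof -
  let ?f = "\<lambda>z::int. nat \<bar>z\<bar>"
  have "- int n \<in> set \<sigma> \<longleftrightarrow> int n \<notin> set \<sigma>"
    if im: "image_mset ?f (mset \<sigma>) = (\<Sum>i\<in>{1..<n}. replicate_mset 2 i) + {#n#}"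
  proof -
    have "count (\<Sum>i\<in>{1..<n}. replicate_mset 2 i) n = 0"
      by (auto simp: count_eq_zero_iff set_mset_sum)
    then have one: "count (image_mset ?f (mset \<sigma>)) n = 1" by (simp add: im)
    have "n \<in># image_mset ?f (mset \<sigma>)" by (simp add: im)
    then obtain z where "z \<in> set \<sigma>" "n = nat \<bar>z\<bar>" by auto
    then have "z = int n \<or> z = - int n" by auto
    with \<open>z \<in> set \<sigma>\<close> have "- int n \<in> set \<sigma> \<or> int n \<in> set \<sigma>" by auto
    moreover have False if "- int n \<in> set \<sigma>" "int n \<in> set \<sigma>"
    proof -
      \<comment> \<open>As \<open>n > 0\<close>, the two letters differ; together they would give
        the absolute value \<open>n\<close> multiplicity two.\<close>
      have "{#- int n, int n#} \<subseteq># mset \<sigma>"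
        using that n by (intro mset_subset_eqI) (auto simp: count_eq_zero_iff Suc_le_eq)
      then have "image_mset ?f {#- int n, int n#} \<subseteq># image_mset ?f (mset \<sigma>)"
        by (rule image_mset_subseteq_mono)
      then have "count (image_mset ?f {#- int n, int n#}) n \<le> 1"
        using one mset_subset_eq_count by metis
      then show False by simp
    qed
    ultimately show ?thesis by blast
  qed
  then show ?thesis by (auto simp: V_def signed_perms_def)
qed

text \<open>Each multiset has exactly one sorted arrangement; this turns counting barred words into
  counting multisets.\<close>

lemma bij_betw_mset_sorted:
  "bij_betw mset {xs :: 'a :: linorder list. sorted xs \<and> P (mset xs)} {A. P A}"
  by (rule bij_betw_byWitness[where f' = sorted_list_of_multiset])
     (auto simp: sorted_sort_id)

lemma sum_card_barred:
  assumes n: "n > 0"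
  shows "(\<Sum>\<sigma>\<in>V n. card (barred \<sigma> t)) = (t + 1) * ((t + 1) * (2 * t + 1)) ^ (n - 1)"
proof -
  let ?M = "(\<Sum>i\<in>{1..<n}. replicate_mset 2 i) + {#n#}"
  \<comment> \<open>The sets are disjoint because the second components of a barred word recover
    \<open>\<sigma>\<close>.\<close>
  have "(\<Sum>\<sigma>\<in>V n. card (barred \<sigma> t)) = card (\<Union>\<sigma>\<in>V n. barred \<sigma> t)"
    by (rule card_UN_disjoint[symmetric]) (auto simp: finite_V finite_barred, auto simp: barred_def)
  also have "(\<Union>\<sigma>\<in>V n. barred \<sigma> t) = {xs. sorted xs \<and> mset xs \<in> lifts (slots t n) letter ?M}"
  proof (intro set_eqI)
    fix xs :: "(nat \<times> int) list"
    have im: "image_mset (\<lambda>z. nat \<bar>z\<bar>) (mset (map snd xs)) = image_mset letter (mset xs)"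
      by (simp add: image_mset.compositionality comp_def)
    have "(\<forall>p\<in>set xs. p \<le> (t, 0)) \<and> int n \<notin> set (map snd xs) \<longleftrightarrow> set xs \<subseteq> slots t n"
      unfolding slots_def by (force simp del: less_eq_prod_simp)
    moreover have "xs \<in> (\<Union>\<sigma>\<in>V n. barred \<sigma> t) \<longleftrightarrow>
        map snd xs \<in> V n \<and> sorted xs \<and> (\<forall>p\<in>set xs. p \<le> (t, 0))"
      unfolding barred_def sorted_append by auto
    ultimately show "xs \<in> (\<Union>\<sigma>\<in>V n. barred \<sigma> t) \<longleftrightarrow>
        xs \<in> {xs. sorted xs \<and> mset xs \<in> lifts (slots t n) letter ?M}"
      unfolding V_iff[OF n] im lifts_def mem_Collect_eq set_mset_mset by blast
  qed
  also have "card \<dots> = card (lifts (slots t n) letter ?M)"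
    using bij_betw_same_card[OF bij_betw_mset_sorted[of "\<lambda>A. A \<in> lifts (slots t n) letter ?M"]]
    by simp
  also have "\<dots> = card (lifts (slots t n) letter (\<Sum>i\<in>{1..<n}. replicate_mset 2 i)) * (t + 1)"
    using n by (subst card_lifts_union) (auto simp: set_mset_sum card_lifts_single slots_single)
  finally show ?thesis using card_lifts_doubles[of "n - 1" n t] n by (simp add: mult_ac)
qed

lemma V_gf:
  "(\<Sum>\<sigma>\<in>V (Suc N). fps_X ^ des_B \<sigma>) = (1 - fps_X) ^ (2*N+2) *
     Abs_fps (\<lambda>t. (int t + 1) * ((int t + 1) * (2 * int t + 1)) ^ N)"
proof -
  have len: "length \<sigma> = 2*N+1" if "\<sigma> \<in> V (Suc N)" for \<sigma>
  proof -
    have "size (image_mset (\<lambda>z. nat \<bar>z\<bar>) (mset \<sigma>)) =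
        size ((\<Sum>i\<in>{1..<Suc N}. replicate_mset 2 i) + {#Suc N#})"
      using that V_iff[of "Suc N" \<sigma>] by simp
    then show ?thesis by (simp add: size_multiset_sum del: sum.op_ivl_Suc)
  qed
  have "(\<Sum>\<sigma>\<in>V (Suc N). fps_X ^ des_B \<sigma>) =
      (\<Sum>\<sigma>\<in>V (Suc N). (1 - fps_X) ^ (2*N+2) * Abs_fps (\<lambda>t. int (card (barred \<sigma> t))))"
    by (intro sum.cong refl) (simp add: barred_gf len)
  also have "\<dots> = (1 - fps_X) ^ (2*N+2) * (\<Sum>\<sigma>\<in>V (Suc N). Abs_fps (\<lambda>t. int (card (barred \<sigma> t))))"
    by (simp add: sum_distrib_left)
  also have "(\<Sum>\<sigma>\<in>V (Suc N). Abs_fps (\<lambda>t. int (card (barred \<sigma> t)))) =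
      Abs_fps (\<lambda>t. (int t + 1) * ((int t + 1) * (2 * int t + 1)) ^ N)"
  proof (rule fps_ext)
    fix t
    show "fps_nth (\<Sum>\<sigma>\<in>V (Suc N). Abs_fps (\<lambda>t. int (card (barred \<sigma> t)))) t =
      fps_nth (Abs_fps (\<lambda>t. (int t + 1) * ((int t + 1) * (2 * int t + 1)) ^ N)) t"
      using arg_cong[OF sum_card_barred[of "Suc N" t], of int]
      by (simp add: fps_sum_nth algebra_simps)
  qed
  finally show ?thesis .
qed

theorem theorem3p1:
  fixes n :: nat
  assumes "n \<ge> 1"
  shows "(\<Sum>\<sigma>\<in>V n. monom (1 :: int) (des_B \<sigma>)) = (\<Sum>e\<in>I (2 * n - 1). monom 1 (asc s_seq e))"
proof -
  obtain N where N: "n = Suc N" using assms by (cases n) auto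
  then have "2 * n - 1 = 2 * N + 1" by simp
  then have "fps_of_poly (\<Sum>\<sigma>\<in>V n. monom (1 :: int) (des_B \<sigma>)) =
      fps_of_poly (\<Sum>e\<in>I (2 * n - 1). monom 1 (asc s_seq e))"
    unfolding fps_of_poly_sum fps_of_poly_monom' N by (simp only: V_gf inv_seqs_gf)
  then show ?thesis by (simp only: fps_of_poly_eq_iff)
qed

end
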